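(* Let $q=4$ and $V=\mathbb{F}_4^{\,5}$. Then $\Gamma$ is a connected graph of diameter $3$ with $162$ vertices, and every vertex of $\Gamma$ has degree $25$. Moreover, for every simplex line $L$: (1) there are precisely $6$ simplex lines $L_1,\dots,L_6$ at distance $3$ from $L$ in $\Gamma$; (2) there are precisely $130$ simplex lines at distance $2$ from $L$ in $\Gamma$, and the set of all such lines is the union of three mutually disjoint subsets $\mathcal{X}^3_{20},\mathcal{X}^1_{90},\mathcal{X}^0_{20}$, where $\mathcal{X}^3_{20}$ consists of $20$ simplex lines each adjacent (in $\Gamma$) to precisely three distinct $L_i$, $\mathcal{X}^1_{90}$ consists of $90$ simplex lines each adjacent to a unique $L_i$, and $\mathcal{X}^0_{20}$ consists of $20$ simplex lines disjoint (meeting only in $0$) with all $L_i$; (3) the set $\{L,L_1,\dots,L_6\}\cup\mathcal{X}^0_{20}$ is a spread of the set of all $135$ simplex points, i.e. it consists of $27$ mutually disjoint simplex lines which together cover all simplex points.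
   Context: A vector of $V=\mathbb{F}_4^{\,5}$ is a simplex vector if precisely one of its coordinates is zero. A point is a $1$-dimensional subspace, a line a $2$-dimensional subspace. A simplex point is a point spanned by a simplex vector; a simplex line is a line all of whose non-zero vectors are simplex vectors (i.e. a $4$-ary simplex code of dimension $2$). $\Gamma$ is the graph whose vertices are all simplex lines, two distinct simplex lines being adjacent if their intersection is $1$-dimensional; distance is the graph distance in $\Gamma$. *)

theory Defs
  imports "HOL-Analysis.Cartesian_Space" "Graph_Theory.Graph_Theory"
begin

definition simplex_vector :: "'a::field ^ 5 \<Rightarrow> bool" where
  "simplex_vector x \<longleftrightarrow> (\<exists>!i. x $ i = 0)"

definition point :: "('a::field ^ 5) set \<Rightarrow> bool" where
  "point P \<longleftrightarrow> vec.subspace P \<and> vec.dim P = 1"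

definition line :: "('a::field ^ 5) set \<Rightarrow> bool" where
  "line L \<longleftrightarrow> vec.subspace L \<and> vec.dim L = 2"

definition simplex_point :: "('a::field ^ 5) set \<Rightarrow> bool" where
  "simplex_point P \<longleftrightarrow> point P \<and> (\<exists>x. simplex_vector x \<and> P = vec.span {x})"

definition simplex_line :: "('a::field ^ 5) set \<Rightarrow> bool" where
  "simplex_line L \<longleftrightarrow> line L \<and> (\<forall>x\<in>L. x \<noteq> 0 \<longrightarrow> simplex_vector x)"

text \<open>Undirected graphs are encoded as symmetric digraphs: an edge is a pair of opposite arcs, and
  the degree of a vertex is its out-degree.\<close>

definition simplex_graph :: "('a::field ^ 5) set pair_pre_digraph" where
  "simplex_graph = \<lparr>pverts = {L. simplex_line L},
     parcs = {(L, M). simplex_line L \<and> simplex_line M \<and> L \<noteq> M \<and> vec.dim (L \<inter> M) = 1}\<rparr>"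

lemma pair_graph_simplex_graph:
  "pair_graph (simplex_graph :: ('a::{field,finite} ^ 5) set pair_pre_digraph)"
  by unfold_locales (auto simp: simplex_graph_def symmetric_def sym_def Int_commute)

text \<open>With all arc weights equal to 1, the cost of a walk is its length, so the shortest-path
  distance is the usual graph distance (infinite between different components).\<close>

definition graph_distance :: "('v, 'e) pre_digraph \<Rightarrow> 'v \<Rightarrow> 'v \<Rightarrow> ereal" where
  "graph_distance G u v = wf_digraph.\<mu> G (\<lambda>_. 1) u v"

definition graph_diameter :: "('v, 'e) pre_digraph \<Rightarrow> ereal" where
  "graph_diameter G = (SUP u\<in>verts G. SUP v\<in>verts G. graph_distance G u v)"

definition at_distance :: "('v, 'e) pre_digraph \<Rightarrow> 'v \<Rightarrow> nat \<Rightarrow> 'v set" where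
  "at_distance G u k = {v \<in> verts G. graph_distance G u v = ereal (real k)}"

definition disjoint_lines :: "('a::field ^ 5) set \<Rightarrow> ('a ^ 5) set \<Rightarrow> bool" where
  "disjoint_lines L M \<longleftrightarrow> L \<inter> M = {0}"

definition simplex_spread :: "('a::field ^ 5) set set \<Rightarrow> bool" where
  "simplex_spread S \<longleftrightarrow> (\<forall>L\<in>S. simplex_line L) \<and> pairwise disjoint_lines S \<and>
     (\<forall>P. simplex_point P \<longrightarrow> (\<exists>L\<in>S. P \<subseteq> L))"

end

theory Submission
  imports Defs
begin

text \<open>
  A simplex line meets the coordinate hyperplanes in its five distinct points, so a suitable diagonal
  rescaling of the coordinates and a suitable choice of a generator \<open>w\<close> of the multiplicative group
  bring any simplex line into the standard form \<open>(x, y, x + y, x + w y, x + (w + 1) y)\<close>.  In the rescaled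
  coordinates every simplex line has a unique systematic generator matrix, of which there are 162,
  and two lines intersect exactly if their matrices encode some non-zero message equally.  Distances
  from the standard line, the partition and the spread are thereby reduced to computations with
  explicit matrices.
\<close>

section \<open>Systematic generator matrices over the field with four elements\<close>

text \<open>The field \<open>'a\<close> is an arbitrary type with four elements, so nothing can be
  evaluated in it. Hence the tabulated arithmetic of \<open>f4\<close>, over which lists of codes
  are evaluated once; the isomorphism \<open>scalar\<close> carries the results over to
  \<open>'a\<close>. The claims concern every line \<open>L\<close>, but no transitive group of
  automorphisms is constructed. Each \<open>L\<close> gets its own coordinate system instead.
  Scaling coordinates by non-zero constants moves no zeros, so in every such system the simplex
  lines are named by the same 162 codes, and the system can be chosen so that \<open>L\<close> is
  named by \<open>base\<close>. One evaluation for \<open>base\<close> thus serves all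
  \<open>L\<close>. The standard form exists because the quotients of the two entries in the five
  columns of a generator matrix run through 0, infinity and the three units, each once. Scaling
  normalises one unit quotient to 1; calling the next one \<open>w\<close> leaves only
  \<open>w + 1\<close> for the last, so neither a permutation of coordinates nor the Frobenius map
  is required.\<close>

text \<open>\<open>Fw\<close> and \<open>Fv\<close> stand for a generator \<open>w\<close> of the multiplicative group and for \<open>w + 1 = w\<^sup>2\<close>.\<close>

datatype f4 = F0 | F1 | Fw | Fv

instantiation f4 :: "{plus, times}"
begin

fun plus_f4 :: "f4 \<Rightarrow> f4 \<Rightarrow> f4" where
  "F0 + y = y"
| "x + F0 = x"
| "F1 + F1 = F0" | "F1 + Fw = Fv" | "F1 + Fv = Fw"
| "Fw + F1 = Fv" | "Fw + Fw = F0" | "Fw + Fv = F1"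
| "Fv + F1 = Fw" | "Fv + Fw = F1" | "Fv + Fv = F0"

fun times_f4 :: "f4 \<Rightarrow> f4 \<Rightarrow> f4" where
  "F0 * y = F0"
| "x * F0 = F0"
| "F1 * y = y"
| "x * F1 = x"
| "Fw * Fw = Fv" | "Fw * Fv = F1"
| "Fv * Fw = F1" | "Fv * Fv = Fw"

instance ..

end

type_synonym word = "f4 \<times> f4 \<times> f4 \<times> f4 \<times> f4"
type_synonym code = "f4 \<times> f4 \<times> f4 \<times> f4 \<times> f4 \<times> f4"

text \<open>A code \<open>(a, b, c, d, e, f)\<close> is the matrix with rows \<open>(1, 0, a, b, c)\<close> and \<open>(0, 1, d, e, f)\<close>.\<close>

fun encode :: "code \<Rightarrow> f4 \<times> f4 \<Rightarrow> word" where
  "encode (a, b, c, d, e, f) (x, y) =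
     (x, y, a * x + d * y, b * x + e * y, c * x + f * y)"

fun simplex_word :: "word \<Rightarrow> bool" where
  "simplex_word (a, b, c, d, e) \<longleftrightarrow>
     of_bool (a = F0) + of_bool (b = F0) + of_bool (c = F0) + of_bool (d = F0) + of_bool (e = F0) = (1::nat)"

definition scalars :: "f4 list" where
  "scalars = [F0, F1, Fw, Fv]"

definition units :: "f4 list" where
  "units = [F1, Fw, Fv]"

definition messages :: "(f4 \<times> f4) list" where
  "messages = filter (\<lambda>m. m \<noteq> (F0, F0)) (List.product scalars scalars)"

definition words :: "word list" where
  "words = List.product scalars (List.product scalars (List.product scalars
     (List.product scalars scalars)))"

text \<open>Each row has its only zero among the first two columns, so just the units are enumerated
  for the rest. The filter amounts to distinct column quotients \<open>d/a\<close>,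
  \<open>e/b\<close>, \<open>f/c\<close>, which leaves 3^3 * 3! = 162 of the 3^6 matrices.\<close>

definition codes :: "code list" where
  "codes = filter (\<lambda>c. \<forall>m\<in>set messages. simplex_word (encode c m))
     (List.product units (List.product units (List.product units
       (List.product units (List.product units units)))))"

text \<open>One message for both codes suffices: the first two letters of a word are its message, so
  a common word has the same message in both.\<close>

definition meets :: "code \<Rightarrow> code \<Rightarrow> bool" where
  "meets c d \<longleftrightarrow> (\<exists>m\<in>set messages. encode c m = encode d m)"

definition base :: code where
  "base = (F1, F1, F1, F1, Fw, Fv)"

definition sphere1 :: "code list" where
  "sphere1 = filter (\<lambda>c. meets base c \<and> c \<noteq> base) codes"

text \<open>The \<open>let\<close> bindings, here and in the evaluations below, make rewriting compute a list once
  instead of once for every element that it is compared with.\<close>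

definition sphere2 :: "code list" where
  "sphere2 = (let S = sphere1 in
     filter (\<lambda>c. \<not> meets base c \<and> (\<exists>d\<in>set S. meets d c)) codes)"

text \<open>By construction these codes lie beyond distance 2; that the distance is exactly 3 comes
  from \<open>sphere3_meets_sphere2\<close>.\<close>

definition sphere3 :: "code list" where
  "sphere3 = (let S = base # sphere1 in filter (\<lambda>c. \<not> (\<exists>d\<in>set S. meets d c)) codes)"

definition sphere2_class :: "nat \<Rightarrow> code list" where
  "sphere2_class k = (let T = sphere3 in filter (\<lambda>c. length (filter (meets c) T) = k) sphere2)"

definition spread :: "code list" where
  "spread = base # sphere3 @ sphere2_class 0"

section \<open>Counts and incidences obtained by evaluating the lists\<close>

lemma length_codes: "length codes = 162" by code_simp

lemma base_in_codes: "base \<in> set codes" by code_simp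

text \<open>405 = 5 * 3^4: the position of the zero and four units.\<close>

lemma length_simplex_words: "length (filter simplex_word words) = 405" by code_simp

lemma length_sphere1: "length sphere1 = 25" by code_simp

lemma length_sphere2: "length sphere2 = 130" by code_simp

lemma length_sphere3: "length sphere3 = 6" by code_simp

lemma sphere3_meets_sphere2: "\<forall>c\<in>set sphere3. \<exists>d\<in>set sphere2. meets d c"
proof -
  have "let S = sphere2 in \<forall>c\<in>set sphere3. \<exists>d\<in>set S. meets d c"
    by code_simp
  then show ?thesis by (simp only: Let_def)
qed

lemma length_sphere2_classes: "map (\<lambda>k. length (sphere2_class k)) [3, 1, 0] = [20, 90, 20]"
  by code_simp

lemma spread_disjoint: "\<forall>c\<in>set spread. \<forall>d\<in>set spread. meets c d \<longrightarrow> c = d"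
proof -
  have "let S = spread in \<forall>c\<in>set S. \<forall>d\<in>set S. meets c d \<longrightarrow> c = d"
    by code_simp
  then show ?thesis by (simp only: Let_def)
qed

text \<open>The message is read off the first two letters of \<open>z\<close>, so only the code has
  to be searched for.\<close>

lemma spread_covers:
  "\<forall>z\<in>set words. simplex_word z \<longrightarrow> (\<exists>c\<in>set spread. z = encode c (fst z, fst (snd z)))"
proof -
  have "let S = spread in \<forall>z\<in>set words. simplex_word z \<longrightarrow>
      (\<exists>c\<in>set S. z = encode c (fst z, fst (snd z)))"
    by code_simp
  then show ?thesis by (simp only: Let_def)
qed

section \<open>From the evaluated lists to sets of codes and their cardinalities\<close>

lemma mem_scalars: "x \<in> set scalars"
  by (cases x) (simp_all add: scalars_def)

lemma mem_units: "x \<in> set units \<longleftrightarrow> x \<noteq> F0"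
  by (cases x) (simp_all add: units_def)

lemma mem_words: "z \<in> set words"
  by (cases z) (simp add: words_def mem_scalars)

lemma mem_messages: "m \<in> set messages \<longleftrightarrow> m \<noteq> (F0, F0)"
  by (cases m) (simp add: messages_def mem_scalars)

lemma f4_mult_simps [simp]: "x * F0 = F0" "F1 * x = x" "x * F1 = x"
  by (cases x; simp)+

lemma f4_add_simps [simp]: "x + F0 = x"
  by (cases x; simp)

lemma encode_00 [simp]: "encode c (F0, F0) = (F0, F0, F0, F0, F0)"
  by (cases c) simp

lemma encode_message:
  "fst (encode c m) = fst m" "fst (snd (encode c m)) = snd m"
  by (cases c; cases m; simp)+

lemma encode_eq_imp_message_eq: "encode c m = encode d n \<Longrightarrow> m = n"
  by (metis encode_message prod.expand)

lemma encode_inject: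
  assumes "encode c = encode d"
  shows "c = d"
proof -
  have "encode c (F1, F0) = encode d (F1, F0)" "encode c (F0, F1) = encode d (F0, F1)"
    by (simp_all add: assms)
  then show ?thesis
    by (cases c; cases d) simp
qed

text \<open>Justifies enumerating units only: the words of the two unit messages already contain a
  zero, so their other letters are non-zero.\<close>

lemma mem_codes: "c \<in> set codes \<longleftrightarrow> (\<forall>m. m \<noteq> (F0, F0) \<longrightarrow> simplex_word (encode c m))"
proof
  assume R: "\<forall>m. m \<noteq> (F0, F0) \<longrightarrow> simplex_word (encode c m)"
  obtain a1 a2 a3 b1 b2 b3 where c: "c = (a1, a2, a3, b1, b2, b3)"
    by (cases c)
  have "a1 \<noteq> F0 \<and> a2 \<noteq> F0 \<and> a3 \<noteq> F0" "b1 \<noteq> F0 \<and> b2 \<noteq> F0 \<and> b3 \<noteq> F0"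
    using R[rule_format, of "(F1, F0)"] R[rule_format, of "(F0, F1)"] by (simp_all add: c)
  with R show "c \<in> set codes"
    by (simp add: c codes_def mem_messages mem_units del: encode.simps split_paired_All)
qed (simp add: codes_def mem_messages)

lemma meets_iff: "meets c d \<longleftrightarrow> (\<exists>m. m \<noteq> (F0, F0) \<and> encode c m = encode d m)"
  unfolding meets_def Bex_def mem_messages by (rule refl)

lemma meets_refl: "meets c c"
  unfolding meets_iff by (rule exI[of _ "(F1, F0)"]) simp

lemma distinct_codes: "distinct codes"
proof -
  have "distinct units"
    by (simp add: units_def)
  then show ?thesis
    by (simp add: codes_def distinct_product)
qed

lemma distinct_words: "distinct words"
proof -
  have "distinct scalars"
    by (simp add: scalars_def)
  then show ?thesis
    by (simp add: words_def distinct_product)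
qed

lemma distinct_spheres: "distinct sphere1" "distinct sphere2" "distinct sphere3"
  by (simp_all add: sphere1_def sphere2_def sphere3_def Let_def distinct_codes)

lemma card_spheres:
  "card (set sphere1) = 25" "card (set sphere2) = 130" "card (set sphere3) = 6"
  by (simp_all add: distinct_card distinct_spheres length_sphere1 length_sphere2 length_sphere3)

lemma distinct_sphere2_class: "distinct (sphere2_class k)"
  by (simp add: sphere2_class_def distinct_spheres)

lemma card_sphere2_class:
  "card (set (sphere2_class 3)) = 20" "card (set (sphere2_class 1)) = 90" "card (set (sphere2_class 0)) = 20"
  using length_sphere2_classes by (simp_all add: distinct_card distinct_sphere2_class del: One_nat_def)

lemma sphere2_class_disjoint: "j \<noteq> k \<Longrightarrow> set (sphere2_class j) \<inter> set (sphere2_class k) = {}"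
  by (auto simp: sphere2_class_def)

lemma mem_sphere2_class:
  "c \<in> set (sphere2_class k) \<longleftrightarrow> c \<in> set sphere2 \<and> card {d \<in> set sphere3. meets c d} = k"
proof -
  have "length (filter (meets c) sphere3) = card {d \<in> set sphere3. meets c d}"
    by (subst distinct_card[symmetric]) (simp_all add: distinct_spheres)
  then show ?thesis
    by (simp add: sphere2_class_def)
qed

text \<open>The three classes are disjoint and 20 + 90 + 20 = 130, so no other number of neighbours
  in \<open>sphere3\<close> can occur.\<close>

lemma sphere2_eq: "set sphere2 = set (sphere2_class 3) \<union> set (sphere2_class 1) \<union> set (sphere2_class 0)"
proof (rule sym, rule card_subset_eq)
  show "set (sphere2_class 3) \<union> set (sphere2_class 1) \<union> set (sphere2_class 0) \<subseteq> set sphere2"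
    by (auto simp: mem_sphere2_class)
  show "card (set (sphere2_class 3) \<union> set (sphere2_class 1) \<union> set (sphere2_class 0)) = card (set sphere2)"
    by (simp add: card_Un_disjoint Int_Un_distrib2 sphere2_class_disjoint card_sphere2_class card_spheres del: One_nat_def)
qed simp

lemma ball1_eq: "{c \<in> set codes. meets base c} = insert base (set sphere1)"
  unfolding sphere1_def set_filter using meets_refl base_in_codes by blast

lemma ball2_eq: "{c \<in> set codes. \<exists>d\<in>insert base (set sphere1). meets d c} = set codes - set sphere3"
  by (auto simp: sphere3_def Let_def)

text \<open>A code of \<open>sphere3\<close> meets one of \<open>sphere2\<close>; any other code
  meets itself.\<close>

lemma ball3_eq: "{c \<in> set codes. \<exists>d\<in>set codes - set sphere3. meets d c} = set codes"
proof -
  have "\<exists>d\<in>set codes - set sphere3. meets d c" if "c \<in> set codes" for c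
  proof (cases "c \<in> set sphere3")
    case True
    moreover have "set sphere2 \<subseteq> set codes - set sphere3"
      by (auto simp: sphere2_def sphere3_def Let_def)
    ultimately show ?thesis
      using sphere3_meets_sphere2 by blast
  qed (use that meets_refl in blast)
  then show ?thesis
    by blast
qed

lemma sphere2_eq_diff: "set codes - set sphere3 - insert base (set sphere1) = set sphere2"
proof -
  have "c \<in> insert base (set sphere1) \<longleftrightarrow> meets base c" if "c \<in> set codes" for c
    using ball1_eq that by blast
  then show ?thesis
    unfolding sphere2_def sphere3_def Let_def set_filter list.set by blast
qed

lemma spheres_subset_codes: "set sphere1 \<subseteq> set codes" "set sphere2 \<subseteq> set codes" "set sphere3 \<subseteq> set codes"
  by (auto simp: sphere1_def sphere2_def sphere3_def Let_def)

lemma card_spread: "card (set spread) = 27"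
proof -
  have "base \<notin> set sphere3 \<union> set (sphere2_class 0)"
    using meets_refl[of base] by (auto simp: sphere3_def sphere2_def sphere2_class_def Let_def)
  moreover have "set sphere3 \<inter> set (sphere2_class 0) = {}"
    by (auto simp: sphere3_def sphere2_def sphere2_class_def Let_def)
  ultimately show ?thesis
    by (simp add: spread_def card_Un_disjoint card_spheres card_sphere2_class)
qed

lemma spread_subset_codes: "set spread \<subseteq> set codes"
  using base_in_codes spheres_subset_codes by (auto simp: spread_def mem_sphere2_class)

section \<open>Simplex vectors, points and lines\<close>

text \<open>Translation by 1 permutes the field, so the sum of all elements equals itself plus 4;
  hence 4 = (1 + 1)^2 = 0 and the characteristic is 2. The value of \<open>w * w\<close> follows by
  excluding 0, \<open>w\<close> and 1.\<close>

lemma four_element_field: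
  fixes w :: "'a::{field,finite}"
  assumes card: "CARD('a) = 4" and w: "w \<noteq> 0" "w \<noteq> 1"
  shows "\<And>x::'a. x + x = 0" and "UNIV = {0, 1, w, w + 1}" and "w * w = w + 1" and "w + 1 \<noteq> w" "w + 1 \<noteq> 0" "w + 1 \<noteq> 1"
proof -
  have "sum id (UNIV :: 'a set) = (\<Sum>x\<in>UNIV. x + 1)"
    by (rule sum.reindex_bij_witness[of _ "\<lambda>x. x + 1" "\<lambda>x. x - 1"]) auto
  also have "\<dots> = sum id (UNIV :: 'a set) + of_nat CARD('a)"
    by (simp add: sum.distrib)
  finally have "(1 + 1) * (1 + 1) = (0::'a)"
    by (simp add: card)
  then have two: "(1::'a) + 1 = 0"
    by (simp only: mult_eq_0_iff) simp
  then show double: "x + x = 0" for x :: 'a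
    by (metis distrib_left mult_1_right mult_zero_right)
  show w1: "w + 1 \<noteq> w" "w + 1 \<noteq> 0" "w + 1 \<noteq> 1"
    using w two by (simp_all, metis add_right_cancel)
  show univ: "UNIV = {0, 1, w, w + 1}"
    by (rule sym, rule card_subset_eq) (use w w1 card in auto)
  have "w * w \<noteq> 0" "w * w \<noteq> w"
    using w by auto
  moreover have "w * w \<noteq> 1"
  proof
    assume "w * w = 1"
    then have "(w + 1) * (w + 1) = (1 + 1) + (w + w)"
      by (simp add: algebra_simps)
    then show False
      using w1 two double by simp
  qed
  ultimately show "w * w = w + 1"
    using univ by blast
qed

lemma exhaust_5:
  fixes x :: 5
  shows "x = 1 \<or> x = 2 \<or> x = 3 \<or> x = 4 \<or> x = 5"
proof (induct x)
  case (of_int z)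
  then have "z = 0 \<or> z = 1 \<or> z = 2 \<or> z = 3 \<or> z = 4" by fastforce
  then show ?case by auto
qed

lemma UNIV_5: "UNIV = {1, 2, 3, 4, 5::5}"
  using exhaust_5 by auto

lemma forall_5: "(\<forall>i::5. P i) \<longleftrightarrow> P 1 \<and> P 2 \<and> P 3 \<and> P 4 \<and> P 5"
  by (metis exhaust_5)

text \<open>Counting zeros matches the form of \<open>simplex_word\<close>, so the two notions can
  be compared coordinate by coordinate.\<close>

lemma simplex_vector_iff:
  "simplex_vector x \<longleftrightarrow> of_bool (x $ 1 = 0) + of_bool (x $ 2 = 0) + of_bool (x $ 3 = 0)
     + of_bool (x $ 4 = 0) + of_bool (x $ 5 = 0) = (1::nat)"
proof -
  have "simplex_vector x \<longleftrightarrow> card {i. x $ i = 0} = 1"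
    unfolding simplex_vector_def by (auto simp: card_1_singleton_iff set_eq_iff Ex1_def)
  also have "card {i. x $ i = 0} = (\<Sum>i\<in>UNIV. of_bool (x $ i = 0))"
    by simp
  also have "\<dots> = of_bool (x $ 1 = 0) + of_bool (x $ 2 = 0) + of_bool (x $ 3 = 0)
     + of_bool (x $ 4 = 0) + of_bool (x $ 5 = 0)"
    unfolding UNIV_5 by (simp del: sum_of_bool_eq)
  finally show ?thesis .
qed


lemma span_pair_iff: "x \<in> vec.span {u, v} \<longleftrightarrow> (\<exists>a b. x = a *s u + b *s v)"
  for x :: "'a::field ^ 'n"
  by (auto simp: vec.span_breakdown_eq vec.span_singleton image_iff diff_eq_eq add.commute) 

text \<open>Applied to differences, this says that any two coordinates determine a vector of a
  simplex line.\<close>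

lemma simplex_line_two_zeros:
  assumes "simplex_line M" "x \<in> M" "x $ i = 0" "x $ j = 0" "i \<noteq> j"
  shows "x = 0"
  using assms unfolding simplex_line_def simplex_vector_def by metis

lemma simplex_line_subspace: "simplex_line M \<Longrightarrow> vec.subspace M"
  by (simp add: simplex_line_def line_def)

lemma simplex_line_unit:
  assumes M: "simplex_line M" and ij: "i \<noteq> j"
  shows "\<exists>u\<in>M. u $ i = 1 \<and> u $ j = 0"
proof -
  note sub = simplex_line_subspace[OF M]
  have dim: "vec.dim M = 2"
    using M by (simp add: simplex_line_def line_def)
  have not_span: "\<exists>b\<in>M. b \<notin> vec.span W" if "finite W" "card W < 2" for W
    using vec.dim_le_card[of M W] that dim by auto
  obtain b where b: "b \<in> M" "b \<noteq> 0"
    using not_span[of "{}"] by auto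
  obtain c where c: "c \<in> M" "c \<notin> vec.span {b}"
    using not_span[of "{b}"] by auto
  \<comment> \<open>Gaussian elimination of coordinate \<open>j\<close>; the result is non-zero
    because \<open>c\<close> is not a multiple of \<open>b\<close>.\<close>
  define d where "d = (if b $ j = 0 then b else c - (c $ j / b $ j) *s b)"
  have d: "d \<in> M" "d \<noteq> 0" "d $ j = 0"
    using b c sub by (auto simp: d_def vec.span_singleton vec.subspace_diff vec.subspace_scale)
  then have "d $ i \<noteq> 0"
    using simplex_line_two_zeros[OF M _ _ _ ij] by blast
  then show ?thesis
    using d sub by (intro bexI[of _ "(1 / d $ i) *s d"]) (auto simp: vec.subspace_scale)
qed

lemma simplex_line_eq_span:
  assumes M: "simplex_line M" and U: "U \<in> M" and V: "V \<in> M"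
    and nth: "U $ i \<noteq> 0" "U $ j = 0" "V $ i = 0" "V $ j \<noteq> 0"
  shows "M = vec.span {U, V}"
proof (intro equalityI subsetI)
  note sub = simplex_line_subspace[OF M]
  fix x assume "x \<in> M"
  \<comment> \<open>The combination of \<open>U\<close> and \<open>V\<close> that agrees with
    \<open>x\<close> in coordinates \<open>i\<close> and \<open>j\<close>.\<close>
  define y where "y = (x $ i / U $ i) *s U + (x $ j / V $ j) *s V"
  have "x - y \<in> M"
    using sub U V \<open>x \<in> M\<close> by (simp add: y_def vec.subspace_add vec.subspace_diff vec.subspace_scale)
  then have "x - y = 0"
    by (rule simplex_line_two_zeros[OF M, of _ i j]) (use nth in \<open>auto simp: y_def\<close>)
  then show "x \<in> vec.span {U, V}"
    by (auto simp: span_pair_iff y_def)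
next
  fix x assume "x \<in> vec.span {U, V}"
  then show "x \<in> M"
    using vec.span_minimal[of "{U, V}" M] simplex_line_subspace[OF M] U V by auto
qed

text \<open>Dimension 2 would force \<open>L = M\<close>, which leaves 0 or 1. Adjacency thereby
  becomes failure of disjointness.\<close>

lemma dim_Int_lines:
  assumes "line L" "line M" "L \<noteq> M"
  shows "vec.dim (L \<inter> M) = 1 \<longleftrightarrow> \<not> disjoint_lines L M"
proof -
  have sub: "vec.subspace L" "vec.subspace M" "vec.subspace (L \<inter> M)" and dim: "vec.dim L = 2" "vec.dim M = 2"
    using assms by (auto simp: line_def vec.subspace_inter)
  have "vec.dim (L \<inter> M) \<le> 2"
    using dim vec.dim_subset[of "L \<inter> M" L] by simp
  moreover have "vec.dim (L \<inter> M) \<noteq> 2"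
  proof
    assume "vec.dim (L \<inter> M) = 2"
    then have "L \<inter> M = L" "L \<inter> M = M"
      using sub dim by (simp_all add: vec.subspace_dim_equal)
    with \<open>L \<noteq> M\<close> show False by simp
  qed
  moreover have "vec.dim (L \<inter> M) = 0 \<longleftrightarrow> disjoint_lines L M"
    using vec.subspace_0[OF sub(3)] by (auto simp: disjoint_lines_def)
  ultimately show ?thesis
    by linarith
qed

section \<open>Counting simplex points\<close>

lemma simplex_point_iff: "simplex_point P \<longleftrightarrow> (\<exists>x. simplex_vector x \<and> P = vec.span {x})"
proof -
  have "point (vec.span {x})" if "simplex_vector x" for x :: "'a ^ 5"
  proof -
    have "x \<noteq> 0"
    proof
      assume "x = 0"
      with that have "\<exists>!i::5. True"
        by (simp add: simplex_vector_def)
      then have "(1::5) = 2" by blast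
      then show False by simp
    qed
    then show ?thesis
      by (simp add: point_def vec.dim_eq_card_independent)
  qed
  then show ?thesis
    by (auto simp: simplex_point_def)
qed

lemma simplex_vector_nonzero: "simplex_vector x \<Longrightarrow> x \<noteq> 0"
  by (auto simp: simplex_vector_iff)

lemma simplex_vector_scale: "k \<noteq> 0 \<Longrightarrow> simplex_vector (k *s x) \<longleftrightarrow> simplex_vector x"
  by (simp add: simplex_vector_def)

text \<open>The simplex points with 0 removed partition the simplex vectors into blocks of
  \<open>CARD('a) - 1\<close> multiples each.\<close>

lemma card_simplex_points:
  "(CARD('a::{field,finite}) - 1) * card {P :: ('a ^ 5) set. simplex_point P}
     = card {x :: 'a ^ 5. simplex_vector x}"
proof -
  let ?SP = "{P :: ('a ^ 5) set. simplex_point P}"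
  let ?C = "(\<lambda>P. P - {0}) ` ?SP"
  have span_minus: "vec.span {x} - {0} = (\<lambda>k. k *s x) ` (UNIV - {0})" if "x \<noteq> 0" for x :: "'a ^ 5"
    using that by (auto simp: vec.span_singleton)
  have span_eq: "vec.span {y} = vec.span {x}" if y: "y \<in> vec.span {x} - {0}" for x y :: "'a ^ 5"
  proof -
    obtain k where k: "y = k *s x"
      using y by (auto simp: vec.span_singleton)
    with y have "k \<noteq> 0"
      by auto
    then have "y \<in> vec.span {x}" "x \<in> vec.span {y}"
      using y k vec.span_scale[of y "{y}" "1 / k"] by (auto simp: vec.span_base)
    then show ?thesis
      by (auto simp: vec.span_eq)
  qed
  have "(CARD('a) - 1) * card ?C = card (\<Union> ?C)"
  proof (rule card_partition)
    fix D assume "D \<in> ?C"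
    then obtain x where x: "simplex_vector x" "D = vec.span {x} - {0}"
      by (auto simp: simplex_point_iff)
    moreover have "inj_on (\<lambda>k. k *s x) (UNIV - {0})"
      using simplex_vector_nonzero[OF x(1)] by (auto simp: inj_on_def)
    ultimately show "card D = CARD('a) - 1"
      using span_minus simplex_vector_nonzero by (metis card_image card_Diff_singleton UNIV_I)
  next
    fix D E assume DE: "D \<in> ?C" "E \<in> ?C" "D \<noteq> E"
    then obtain x y where xy: "D = vec.span {x} - {0}" "E = vec.span {y} - {0}"
      by (auto simp: simplex_point_iff)
    show "D \<inter> E = {}"
    proof (rule ccontr)
      assume "D \<inter> E \<noteq> {}"
      then obtain z where "z \<in> D" "z \<in> E" by auto
      then have "vec.span {x} = vec.span {y}"
        using span_eq[of z x] span_eq[of z y] xy by simp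
      with xy DE show False by simp
    qed
  qed simp_all
  moreover have "\<Union> ?C = {x. simplex_vector x}"
  proof (intro equalityI subsetI)
    fix y assume "y \<in> \<Union> ?C"
    then obtain x where x: "simplex_vector x" "y \<in> vec.span {x} - {0}"
      by (auto simp: simplex_point_iff)
    then obtain k where "y = k *s x" "k \<noteq> 0"
      by (auto simp: vec.span_singleton)
    then show "y \<in> {x. simplex_vector x}"
      using x by (simp add: simplex_vector_scale)
  next
    fix x :: "'a ^ 5" assume "x \<in> {x. simplex_vector x}"
    then have "simplex_point (vec.span {x})" "x \<in> vec.span {x} - {0}"
      using simplex_vector_nonzero by (auto simp: simplex_point_iff vec.span_base)
    then show "x \<in> \<Union> ?C"
      by blast
  qed
  moreover have "card ?C = card ?SP"
  proof (rule card_image, rule inj_onI)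
    fix P Q :: "('a ^ 5) set"
    assume "P \<in> ?SP" "Q \<in> ?SP" and eq: "P - {0} = Q - {0}"
    then have "0 \<in> P" "0 \<in> Q"
      unfolding simplex_point_iff using vec.span_zero by blast+
    with eq show "P = Q"
      by blast
  qed
  ultimately show ?thesis
    by (simp only:)
qed

section \<open>Coordinate frames\<close>

locale frame =
  fixes w :: "'a::{field,finite}" and t :: "'a ^ 5"
  assumes card: "CARD('a) = 4" and w0: "w \<noteq> 0" and w1: "w \<noteq> 1" and t0: "\<And>i. t $ i \<noteq> 0"
begin

lemmas field = four_element_field[OF card w0 w1]

fun scalar :: "f4 \<Rightarrow> 'a" where
  "scalar F0 = 0"
| "scalar F1 = 1"
| "scalar Fw = w"
| "scalar Fv = w + 1"

lemma add_self: "x + x = (0::'a)" "x + (x + y) = (y::'a)"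
  using field(1) by (simp_all flip: add.assoc)

lemma scalar_add: "scalar (x + y) = scalar x + scalar y"
  by (cases x; cases y; simp add: add_self ac_simps)

lemma scalar_mult: "scalar (x * y) = scalar x * scalar y"
  by (cases x; cases y; simp add: add_self field(3) distrib_left distrib_right ac_simps)

lemma scalar_inject [simp]: "scalar x = scalar y \<longleftrightarrow> x = y"
  using w0 w1 field(4,5,6) w0[symmetric] w1[symmetric] field(4,5,6)[symmetric]
  by (cases x; cases y) simp_all

lemma scalar_eq_0 [simp]: "scalar x = 0 \<longleftrightarrow> x = F0"
  using scalar_inject[of x F0] by (simp del: scalar_inject)

lemma scalar_surj: "\<exists>y. x = scalar y"
proof -
  have "x \<in> {0, 1, w, w + 1}"
    using field(2) by blast
  then show ?thesis
    by (metis insertE empty_iff scalar.simps)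
qed

fun vec_of :: "word \<Rightarrow> 'a ^ 5" where
  "vec_of (z1, z2, z3, z4, z5) = (\<chi> i. t $ i * scalar
     (if i = 1 then z1 else if i = 2 then z2 else if i = 3 then z3 else if i = 4 then z4 else z5))"

lemma vec_of_nth:
  "vec_of (z1, z2, z3, z4, z5) $ 1 = t $ 1 * scalar z1"
  "vec_of (z1, z2, z3, z4, z5) $ 2 = t $ 2 * scalar z2"
  "vec_of (z1, z2, z3, z4, z5) $ 3 = t $ 3 * scalar z3"
  "vec_of (z1, z2, z3, z4, z5) $ 4 = t $ 4 * scalar z4"
  "vec_of (z1, z2, z3, z4, z5) $ 5 = t $ 5 * scalar z5"
  by simp_all

lemma vec_of_inject: "vec_of y = vec_of z \<longleftrightarrow> y = z"
  by (cases y; cases z) (auto simp: vec_eq_iff forall_5 vec_of_nth t0 simp del: vec_of.simps)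

lemma vec_of_surj: "\<exists>z. x = vec_of z"
proof -
  obtain s where s: "\<And>a. scalar (s a) = a"
    using choice[of "\<lambda>a y. a = scalar y"] scalar_surj by metis
  have "x = vec_of (s (x $ 1 / t $ 1), s (x $ 2 / t $ 2), s (x $ 3 / t $ 3), s (x $ 4 / t $ 4), s (x $ 5 / t $ 5))"
    by (simp add: vec_eq_iff forall_5 vec_of_nth s t0 del: vec_of.simps)
  then show ?thesis ..
qed

lemma vec_of_eq_0: "vec_of z = 0 \<longleftrightarrow> z = (F0, F0, F0, F0, F0)"
  by (cases z) (auto simp: vec_eq_iff forall_5 vec_of_nth t0 simp del: vec_of.simps)

text \<open>Both \<open>scalar\<close> and the scaling by the non-zero \<open>t $ i\<close> preserve
  which coordinates vanish.\<close>

lemma simplex_vector_vec_of: "simplex_vector (vec_of z) \<longleftrightarrow> simplex_word z"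
proof (cases z)
  case (fields z1 z2 z3 z4 z5)
  show ?thesis
    unfolding fields simplex_vector_iff vec_of_nth simplex_word.simps
    by (simp only: mult_eq_0_iff t0 scalar_eq_0 simp_thms)
qed


text \<open>Taking the range of the encoder reduces membership to equality of words; the description
  as a span is \<open>line_of_eq_span\<close>.\<close>

definition line_of :: "code \<Rightarrow> ('a ^ 5) set" where
  "line_of c = range (\<lambda>m. vec_of (encode c m))"

lemma vec_of_encode:
  "vec_of (encode c (x, y)) = scalar x *s vec_of (encode c (F1, F0)) + scalar y *s vec_of (encode c (F0, F1))"
  by (cases c)
    (simp only: vec_eq_iff forall_5 encode.simps vec_of_nth scalar_add scalar_mult scalar.simps
       vector_add_component vector_smult_component, simp add: algebra_simps)

lemma vec_of_encode_nth:
  "vec_of (encode c (x, y)) $ 1 = t $ 1 * scalar x" "vec_of (encode c (x, y)) $ 2 = t $ 2 * scalar y"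
  by (cases c; simp)+

lemma line_of_eq_span: "line_of c = vec.span {vec_of (encode c (F1, F0)), vec_of (encode c (F0, F1))}"
proof -
  have "x \<in> line_of c \<longleftrightarrow> (\<exists>a b. x = a *s vec_of (encode c (F1, F0)) + b *s vec_of (encode c (F0, F1)))" for x
  proof -
    have "x \<in> line_of c \<longleftrightarrow> (\<exists>a b. x = scalar a *s vec_of (encode c (F1, F0)) + scalar b *s vec_of (encode c (F0, F1)))"
      by (simp only: vec_of_encode[symmetric]) (simp add: line_of_def image_iff del: encode.simps)
    then show ?thesis
      by (metis scalar_surj)
  qed
  then show ?thesis
    by (auto simp: span_pair_iff)
qed

text \<open>The identity block in the first two columns makes the rows independent.\<close>

lemma line_line_of: "line (line_of c)"
proof -
  let ?U = "vec_of (encode c (F1, F0))" and ?V = "vec_of (encode c (F0, F1))"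
  have nth: "?U $ 1 \<noteq> 0" "?V $ 1 = 0" "?V $ 2 \<noteq> 0"
    by (simp_all add: vec_of_encode_nth t0)
  then have "?U \<notin> vec.span {?V}" "?V \<noteq> 0"
    by (auto simp: vec.span_singleton simp del: encode.simps)
  then have "vec.independent {?U, ?V}" "?U \<noteq> ?V"
    using vec.span_base[of ?V "{?V}"] by (auto simp: vec.independent_insert simp del: encode.simps)
  then show ?thesis
    using vec.dim_eq_card_independent[of "{?U, ?V}"] by (simp add: line_def line_of_eq_span del: encode.simps)
qed

lemma simplex_line_line_of: "simplex_line (line_of c) \<longleftrightarrow> c \<in> set codes"
proof -
  have "encode c m = (F0, F0, F0, F0, F0) \<longleftrightarrow> m = (F0, F0)" for m
    using encode_eq_imp_message_eq[of c m c "(F0, F0)"] by auto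
  then show ?thesis
    using line_line_of[of c] by (simp add: simplex_line_def line_of_def vec_of_eq_0 simplex_vector_vec_of mem_codes
        del: encode.simps split_paired_All)
qed

lemma line_of_inject: "line_of c = line_of d \<longleftrightarrow> c = d"
proof
  assume eq: "line_of c = line_of d"
  have "encode c m = encode d m" for m
  proof -
    have "vec_of (encode c m) \<in> line_of d"
      unfolding eq[symmetric] unfolding line_of_def by (rule rangeI)
    then obtain n where "encode c m = encode d n"
      by (auto simp: line_of_def vec_of_inject)
    then show ?thesis
      using encode_eq_imp_message_eq by metis
  qed
  then show "c = d"
    by (intro encode_inject ext)
qed simp

lemma line_of_eqI:
  assumes M: "simplex_line M" and "vec_of (encode c (F1, F0)) \<in> M" "vec_of (encode c (F0, F1)) \<in> M"
  shows "M = line_of c"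
  unfolding line_of_eq_span
  by (rule simplex_line_eq_span[OF assms, of 1 2]) (simp_all add: vec_of_encode_nth t0)

lemma simplex_line_imp_line_of:
  assumes M: "simplex_line M"
  shows "\<exists>c\<in>set codes. M = line_of c"
proof -
  obtain u v where u: "u \<in> M" "u $ 1 = 1" "u $ 2 = 0" and v: "v \<in> M" "v $ 2 = 1" "v $ 1 = 0"
    using simplex_line_unit[OF M, of 1 2] simplex_line_unit[OF M, of 2 1] by auto
  \<comment> \<open>The factors \<open>t $ 1\<close> and \<open>t $ 2\<close> compensate the scaling
    in \<open>vec_of\<close>, so that the leading letters become \<open>F1\<close>.\<close>
  obtain y' z' where "t $ 1 *s u = vec_of y'" "t $ 2 *s v = vec_of z'"
    using vec_of_surj by blast
  then obtain y1 y2 a1 a2 a3 z1 z2 b1 b2 b3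
    where y: "t $ 1 *s u = vec_of (y1, y2, a1, a2, a3)" and z: "t $ 2 *s v = vec_of (z1, z2, b1, b2, b3)"
    by (cases y'; cases z') auto
  have "scalar y1 = scalar F1" "scalar y2 = scalar F0"
    using arg_cong[OF y, of "\<lambda>x. x $ 1"] arg_cong[OF y, of "\<lambda>x. x $ 2"]
    by (simp_all only: vec_of_nth) (simp_all add: u t0)
  moreover have "scalar z1 = scalar F0" "scalar z2 = scalar F1"
    using arg_cong[OF z, of "\<lambda>x. x $ 1"] arg_cong[OF z, of "\<lambda>x. x $ 2"]
    by (simp_all only: vec_of_nth) (simp_all add: v t0)
  ultimately have yz: "y1 = F1" "y2 = F0" "z1 = F0" "z2 = F1"
    by (simp_all only: scalar_inject)
  have "vec.subspace M"
    using M by (simp add: simplex_line_def line_def)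
  then have "t $ 1 *s u \<in> M" "t $ 2 *s v \<in> M"
    using u v by (auto intro: vec.subspace_scale)
  then have "M = line_of (a1, a2, a3, b1, b2, b3)"
    by (intro line_of_eqI[OF M]) (simp_all add: y z yz del: vec_of.simps)
  then show ?thesis
    using M simplex_line_line_of by blast
qed

lemma simplex_lines_eq: "{M. simplex_line M} = line_of ` set codes"
  using simplex_line_imp_line_of simplex_line_line_of by auto

lemma disjoint_lines_line_of: "disjoint_lines (line_of c) (line_of d) \<longleftrightarrow> \<not> meets c d"
proof
  assume D: "disjoint_lines (line_of c) (line_of d)"
  show "\<not> meets c d"
  proof
    assume "meets c d"
    then obtain m where m: "m \<noteq> (F0, F0)" "encode c m = encode d m"
      by (auto simp: meets_iff simp del: split_paired_Ex)
    then have "vec_of (encode c m) \<in> line_of c \<inter> line_of d"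
      unfolding line_of_def by (metis IntI rangeI)
    then have "encode c m = encode c (F0, F0)"
      using D unfolding disjoint_lines_def encode_00 vec_of_eq_0[symmetric] by blast
    then show False
      using m encode_eq_imp_message_eq by blast
  qed
next
  assume D: "\<not> meets c d"
  show "disjoint_lines (line_of c) (line_of d)"
    unfolding disjoint_lines_def
  proof (intro equalityI subsetI)
    fix x assume "x \<in> line_of c \<inter> line_of d"
    then obtain m n where x: "x = vec_of (encode c m)" "encode c m = encode d n"
      by (auto simp: line_of_def vec_of_inject)
    moreover from x have "m = n"
      using encode_eq_imp_message_eq by blast
    ultimately have "m = (F0, F0)"
      using D x unfolding meets_iff by blast
    then show "x \<in> {0}"
      using x by (simp add: vec_of_eq_0 del: vec_of.simps)
  next
    fix x :: "'a ^ 5" assume "x \<in> {0}"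
    then show "x \<in> line_of c \<inter> line_of d"
      using line_line_of by (auto simp: line_def vec.subspace_0)
  qed
qed

end

text \<open>With systematic generators \<open>u\<close> and \<open>v\<close>, the rows of
  \<open>base\<close> are to become \<open>u\<close> and a multiple \<open>l *s v\<close>; the
  unknowns are \<open>l\<close>, \<open>w\<close> and the scaling \<open>t\<close>.\<close>

lemma simplex_line_frame:
  fixes L :: "('a::{field,finite} ^ 5) set"
  assumes card: "CARD('a) = 4" and L: "simplex_line L"
  shows "\<exists>w t. frame w t \<and> frame.line_of w t base = L"
proof -
  note sub = simplex_line_subspace[OF L]
  obtain u v where u: "u \<in> L" "u $ 1 = 1" "u $ 2 = 0" and v: "v \<in> L" "v $ 2 = 1" "v $ 1 = 0"
    using simplex_line_unit[OF L, of 1 2] simplex_line_unit[OF L, of 2 1] by auto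
  have u_nz: "u $ i \<noteq> 0" if "i \<noteq> 2" for i
    using simplex_line_two_zeros[OF L u(1) _ u(3), of i] that u by auto
  have v_nz: "v $ i \<noteq> 0" if "i \<noteq> 1" for i
    using simplex_line_two_zeros[OF L v(1) _ v(3), of i] that v by auto
  \<comment> \<open>Chosen so that \<open>u\<close> and \<open>l *s v\<close> agree in coordinate 3,
    where both rows of \<open>base\<close> have \<open>F1\<close>.\<close>
  define l where "l = u $ 3 / v $ 3"
  have l: "l \<noteq> 0" "l * v $ 3 = u $ 3"
    using u_nz[of 3] v_nz[of 3] by (simp_all add: l_def)
  define r where "r i = l * v $ i / u $ i" for i
  have r_nz: "r i \<noteq> 0" if "i \<noteq> 1" "i \<noteq> 2" for i
    using u_nz[of i] v_nz[of i] l that by (simp add: r_def)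
  have r_inj: "r i \<noteq> r j" if "i \<noteq> j" "i \<noteq> 1" "i \<noteq> 2" "j \<noteq> 1" "j \<noteq> 2" for i j
  proof
    assume eq: "r i = r j"
    \<comment> \<open>It vanishes at \<open>i\<close> and \<open>j\<close>, hence is 0, although its
      first coordinate is \<open>- r i\<close>.\<close>
    let ?x = "l *s v - r i *s u"
    have "?x \<in> L"
      using sub u v by (simp add: vec.subspace_diff vec.subspace_scale)
    moreover have "?x $ i = 0" "?x $ j = 0"
      using u_nz[of i] u_nz[of j] that by (simp add: r_def, simp add: eq, simp add: r_def)
    ultimately have "?x = 0"
      using simplex_line_two_zeros[OF L] \<open>i \<noteq> j\<close> by blast
    then have "?x $ 1 = 0"
      by simp
    then show False
      using u v r_nz[of i] that by simp
  qed
  have r3: "r 3 = 1"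
    using u_nz[of 3] l by (simp add: r_def)
  define w where "w = r 4"
  have w: "w \<noteq> 0" "w \<noteq> 1"
    using r_nz[of 4] r_inj[of 4 3] by (simp_all add: w_def r3)
  have "r 5 \<notin> {0, 1, w}"
    using r_nz[of 5] r_inj[of 5 3] r_inj[of 5 4] by (simp add: w_def r3)
  then have r5: "r 5 = w + 1"
    using four_element_field(2)[OF card w] by blast
  \<comment> \<open>The first row prescribes \<open>u $ i\<close> except at coordinate 2, where
    \<open>u\<close> vanishes; there the second row prescribes \<open>l\<close>.\<close>
  define t where "t = (\<chi> i. if i = 2 then l else u $ i)"
  interpret frame w t
    by unfold_locales (use card w u_nz l in \<open>auto simp: t_def\<close>)
  have t: "t $ 1 = 1" "t $ 2 = l" "t $ 3 = u $ 3" "t $ 4 = u $ 4" "t $ 5 = u $ 5"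
    by (simp_all add: t_def u)
  have "vec_of (encode base (F1, F0)) = u"
    by (simp add: vec_eq_iff forall_5 base_def vec_of_nth t u del: vec_of.simps)
  moreover have "l * v $ 4 = u $ 4 * w" "l * v $ 5 = u $ 5 * r 5"
    using u_nz[of 4] u_nz[of 5] by (simp_all add: w_def r_def)
  then have "vec_of (encode base (F0, F1)) = l *s v"
    by (simp add: vec_eq_iff forall_5 base_def vec_of_nth t v l r5 del: vec_of.simps)
  ultimately have "L = line_of base"
    using u v sub by (intro line_of_eqI[OF L]) (simp_all add: vec.subspace_scale)
  then show ?thesis
    using frame_axioms by blast
qed

section \<open>Balls in digraphs\<close>

text \<open>The closed ball of radius \<open>n\<close> about \<open>u\<close>, built by
  breadth-first steps so that each ball can be computed from the previous one.\<close>

primrec near :: "('v, 'e) pre_digraph \<Rightarrow> 'v \<Rightarrow> nat \<Rightarrow> 'v set" where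
  "near G u 0 = {u}"
| "near G u (Suc n) = {v. \<exists>x\<in>near G u n. v = x \<or> x \<rightarrow>\<^bsub>G\<^esub> v}"

context wf_digraph
begin

lemma near_iff_awalk:
  assumes "u \<in> verts G"
  shows "v \<in> near G u n \<longleftrightarrow> (\<exists>p. awalk u p v \<and> length p \<le> n)"
proof (induction n arbitrary: v)
  case 0
  then show ?case
    using assms by (auto simp: awalk_Nil_iff)
next
  case (Suc n)
  show ?case
  proof
    assume "v \<in> near G u (Suc n)"
    then obtain x where x: "x \<in> near G u n" "v = x \<or> x \<rightarrow>\<^bsub>G\<^esub> v"
      by auto
    then obtain p where p: "awalk u p x" "length p \<le> n"
      using Suc by auto
    show "\<exists>p. awalk u p v \<and> length p \<le> Suc n"
    proof (cases "v = x")
      case False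
      then obtain e where "e \<in> arcs G" "tail G e = x" "head G e = v"
        using x by auto
      then have "awalk u (p @ [e]) v"
        using p arc_implies_awalk[of e] by (intro awalk_appendI[of _ _ x]) auto
      then show ?thesis
        using p by (intro exI[of _ "p @ [e]"]) simp
    qed (use p in \<open>auto intro: exI[of _ p]\<close>)
  next
    assume "\<exists>p. awalk u p v \<and> length p \<le> Suc n"
    then obtain p where p: "awalk u p v" "length p \<le> Suc n"
      by blast
    show "v \<in> near G u (Suc n)"
    proof (cases "length p \<le> n")
      case True
      then show ?thesis
        using p Suc by auto
    next
      case False
      then obtain q e where q: "p = q @ [e]" "length q \<le> n"
        using p by (cases p rule: rev_cases) auto
      then obtain x where "awalk u q x" "awalk x [e] v"
        using p by auto
      then have "x \<in> near G u n" "x \<rightarrow>\<^bsub>G\<^esub> v"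
        using Suc q by (auto simp: awalk_simps arcs_ends_conv)
      then show ?thesis
        by auto
    qed
  qed
qed

lemma graph_distance_le:
  assumes "u \<in> verts G" "v \<in> near G u n"
  shows "graph_distance G u v \<le> ereal (real n)"
proof -
  obtain p where p: "awalk u p v" "length p \<le> n"
    using near_iff_awalk assms by blast
  have "awalk_cost (\<lambda>_. 1) p = length p"
    by (induction p) auto
  then show ?thesis
    using min_cost_le_walk_cost[OF p(1), of "\<lambda>_. 1"] p(2)
    by (auto simp: graph_distance_def intro: order_trans)
qed

text \<open>Every walk to \<open>v\<close> has more than \<open>n\<close> arcs. With no walk at all,
  the infimum is infinite and the bound still holds.\<close>

lemma graph_distance_ge:
  assumes "u \<in> verts G" "v \<notin> near G u n"
  shows "graph_distance G u v \<ge> ereal (real (Suc n))"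
  unfolding graph_distance_def \<mu>_def
proof (rule INF_greatest)
  fix p assume p: "p \<in> {p. awalk u p v}"
  have "awalk_cost (\<lambda>_. 1) p = length p"
    by (induction p) auto
  moreover have "length p > n"
    using p assms near_iff_awalk[of u v n] by (auto simp: not_le)
  ultimately show "ereal (real (Suc n)) \<le> ereal (awalk_cost (\<lambda>_. 1) p)"
    by simp
qed

lemma near_subset_verts: "u \<in> verts G \<Longrightarrow> near G u n \<subseteq> verts G"
  by (induction n) auto

lemma at_distance_Suc:
  assumes "u \<in> verts G"
  shows "at_distance G u (Suc n) = near G u (Suc n) - near G u n"
proof (intro equalityI subsetI)
  fix v assume "v \<in> at_distance G u (Suc n)"
  then have v: "v \<in> verts G" "graph_distance G u v = ereal (real (Suc n))"
    by (auto simp: at_distance_def)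
  have "v \<notin> near G u n"
    using graph_distance_le[OF assms, of v n] v by auto
  moreover have "v \<in> near G u (Suc n)"
    using graph_distance_ge[OF assms, of v "Suc n"] v by (cases "v \<in> near G u (Suc n)") auto
  ultimately show "v \<in> near G u (Suc n) - near G u n"
    by blast
next
  fix v assume v: "v \<in> near G u (Suc n) - near G u n"
  then have "graph_distance G u v = ereal (real (Suc n))"
    using graph_distance_le[OF assms, of v "Suc n"] graph_distance_ge[OF assms, of v n]
    by (intro antisym) auto
  then show "v \<in> at_distance G u (Suc n)"
    using v near_subset_verts[OF assms, of "Suc n"] by (auto simp: at_distance_def)
qed

end

section \<open>The graph seen from the standard line\<close>

context frame
begin

abbreviation \<Gamma> :: "(('a ^ 5) set, ('a ^ 5) set \<times> ('a ^ 5) set) pre_digraph" where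
  "\<Gamma> \<equiv> with_proj simplex_graph"

lemma verts_\<Gamma>: "verts \<Gamma> = line_of ` set codes"
  by (simp add: simplex_graph_def simplex_lines_eq)

lemma line_of_adjacent:
  "line_of c \<rightarrow>\<^bsub>\<Gamma>\<^esub> line_of d \<longleftrightarrow> c \<in> set codes \<and> d \<in> set codes \<and> c \<noteq> d \<and> meets c d"
  using dim_Int_lines[OF line_line_of line_line_of, of c d]
  by (auto simp: simplex_graph_def simplex_line_line_of line_of_inject disjoint_lines_line_of)

lemma adjacent_verts: "L \<rightarrow>\<^bsub>\<Gamma>\<^esub> M \<Longrightarrow> L \<in> line_of ` set codes \<and> M \<in> line_of ` set codes"
  by (simp add: simplex_graph_def flip: simplex_lines_eq)

text \<open>Since \<open>meets\<close> is reflexive, it expresses "equal or adjacent", which is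
  exactly one step of \<open>near\<close>.\<close>

lemma near_step:
  assumes "S \<subseteq> set codes" and "near \<Gamma> L n = line_of ` S"
  shows "near \<Gamma> L (Suc n) = line_of ` {c \<in> set codes. \<exists>d\<in>S. meets d c}"
proof (intro equalityI subsetI)
  fix M assume "M \<in> near \<Gamma> L (Suc n)"
  then obtain d where d: "d \<in> S" "M = line_of d \<or> line_of d \<rightarrow>\<^bsub>\<Gamma>\<^esub> M"
    using assms(2) by auto
  then obtain c where c: "M = line_of c" "c \<in> set codes"
    using adjacent_verts assms(1) by blast
  with d have "meets d c"
    by (auto simp: line_of_inject line_of_adjacent meets_refl simp del: with_proj_simps)
  with c d show "M \<in> line_of ` {c \<in> set codes. \<exists>d\<in>S. meets d c}"
    by blast
next
  fix M assume "M \<in> line_of ` {c \<in> set codes. \<exists>d\<in>S. meets d c}"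
  then obtain c d where "M = line_of c" "c \<in> set codes" "d \<in> S" "meets d c"
    by blast
  then have "line_of d \<in> near \<Gamma> L n" "M = line_of d \<or> line_of d \<rightarrow>\<^bsub>\<Gamma>\<^esub> M"
    using assms by (auto simp: line_of_inject line_of_adjacent simp del: with_proj_simps split_paired_Ex)
  then show "M \<in> near \<Gamma> L (Suc n)"
    by auto
qed

lemma near_base:
  "near \<Gamma> (line_of base) 0 = line_of ` {base}"
  "near \<Gamma> (line_of base) 1 = line_of ` insert base (set sphere1)"
  "near \<Gamma> (line_of base) 2 = line_of ` (set codes - set sphere3)"
  "near \<Gamma> (line_of base) 3 = line_of ` set codes"
proof -
  show 0: "near \<Gamma> (line_of base) 0 = line_of ` {base}"
    by simp
  show 1: "near \<Gamma> (line_of base) 1 = line_of ` insert base (set sphere1)"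
    using near_step[OF _ 0] base_in_codes by (simp add: ball1_eq del: near.simps with_proj_simps)
  show 2: "near \<Gamma> (line_of base) 2 = line_of ` (set codes - set sphere3)"
    using near_step[OF _ 1] base_in_codes spheres_subset_codes
    by (simp only: ball2_eq Suc_1 insert_subset simp_thms)
  show "near \<Gamma> (line_of base) 3 = line_of ` set codes"
    using near_step[OF _ 2] by (simp only: ball3_eq Diff_subset numeral_3_eq_3 numeral_2_eq_2 simp_thms)
qed

lemma wf_digraph_\<Gamma>: "wf_digraph \<Gamma>"
  using pair_graph_simplex_graph[where 'a = 'a]
  by (simp add: wf_digraph_wp_iff pair_graph_def pair_digraph_def pair_fin_digraph_def)

lemma inj_line_of: "inj line_of"
  by (simp add: inj_def line_of_inject)

lemma card_line_of_image [simp]: "card (line_of ` S) = card S"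
  using inj_line_of by (meson card_image inj_on_subset subset_UNIV)

lemma base_in_verts: "line_of base \<in> verts \<Gamma>"
  by (simp add: verts_\<Gamma> base_in_codes del: with_proj_simps)

lemma at_distance_base:
  "at_distance \<Gamma> (line_of base) 2 = line_of ` set sphere2"
  "at_distance \<Gamma> (line_of base) 3 = line_of ` set sphere3"
proof -
  show "at_distance \<Gamma> (line_of base) 2 = line_of ` set sphere2"
    using wf_digraph.at_distance_Suc[OF wf_digraph_\<Gamma> base_in_verts, of 1]
    by (simp only: Suc_1 near_base image_set_diff[OF inj_line_of, symmetric] sphere2_eq_diff)
  have "set codes - (set codes - set sphere3) = set sphere3"
    using spheres_subset_codes by blast
  moreover have "Suc 2 = 3"
    by simp
  ultimately show "at_distance \<Gamma> (line_of base) 3 = line_of ` set sphere3"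
    using wf_digraph.at_distance_Suc[OF wf_digraph_\<Gamma> base_in_verts, of 2]
    by (simp only: near_base image_set_diff[OF inj_line_of, symmetric])
qed

lemma graph_distance_base_le:
  assumes "M \<in> verts \<Gamma>"
  shows "graph_distance \<Gamma> (line_of base) M \<le> 3"
  using wf_digraph.graph_distance_le[OF wf_digraph_\<Gamma> base_in_verts, of M 3] assms
  by (simp add: near_base(4) verts_\<Gamma> del: with_proj_simps)

lemma base_reachable:
  assumes "M \<in> verts \<Gamma>"
  shows "line_of base \<rightarrow>\<^sup>*\<^bsub>\<Gamma>\<^esub> M"
proof -
  have "M \<in> near \<Gamma> (line_of base) 3"
    using assms by (simp only: near_base verts_\<Gamma>)
  then show ?thesis
    using wf_digraph.near_iff_awalk[OF wf_digraph_\<Gamma> base_in_verts] wf_digraph.reachable_awalk[OF wf_digraph_\<Gamma>]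
    by metis
qed

lemma out_degree_base: "out_degree \<Gamma> (line_of base) = 25"
proof -
  have "out_arcs \<Gamma> (line_of base) = (\<lambda>M. (line_of base, M)) ` {M. line_of base \<rightarrow>\<^bsub>\<Gamma>\<^esub> M}"
    by (auto simp: out_arcs_def)
  also have "{M. line_of base \<rightarrow>\<^bsub>\<Gamma>\<^esub> M} = line_of ` set sphere1"
  proof -
    have "{M. line_of base \<rightarrow>\<^bsub>\<Gamma>\<^esub> M} = line_of ` {c. line_of base \<rightarrow>\<^bsub>\<Gamma>\<^esub> line_of c}"
      using adjacent_verts by blast
    also have "{c. line_of base \<rightarrow>\<^bsub>\<Gamma>\<^esub> line_of c} = set sphere1"
      using base_in_codes by (auto simp: line_of_adjacent sphere1_def simp del: with_proj_simps)
    finally show ?thesis .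
  qed
  finally show ?thesis
    by (simp add: out_degree_def card_image inj_on_def card_spheres)
qed

lemma sphere3_neighbours:
  assumes "c \<in> set sphere2"
  shows "{N \<in> at_distance \<Gamma> (line_of base) 3. line_of c \<rightarrow>\<^bsub>\<Gamma>\<^esub> N} = line_of ` {d \<in> set sphere3. meets c d}"
proof -
  \<comment> \<open>As \<open>c\<close> lies outside \<open>sphere3\<close>, the inequality required
    for adjacency is automatic.\<close>
  have "c \<in> set codes" "c \<notin> set sphere3"
    using assms by (auto simp: sphere2_def sphere3_def Let_def)
  then show ?thesis
    using spheres_subset_codes unfolding at_distance_base
    by (auto simp: line_of_adjacent simp del: with_proj_simps)
qed

lemma simplex_spread_line_of: "simplex_spread (line_of ` set spread)"
  unfolding simplex_spread_def
proof (intro conjI allI impI)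
  show "\<forall>L\<in>line_of ` set spread. simplex_line L"
    using spread_subset_codes by (auto simp: simplex_line_line_of)
  show "pairwise disjoint_lines (line_of ` set spread)"
    using spread_disjoint by (auto simp: pairwise_def disjoint_lines_line_of)
next
  fix P :: "('a ^ 5) set" assume "simplex_point P"
  then obtain x where x: "simplex_vector x" "P = vec.span {x}"
    by (auto simp: simplex_point_def)
  obtain z where z: "x = vec_of z"
    using vec_of_surj by blast
  with x have "simplex_word z"
    by (simp add: simplex_vector_vec_of)
  then obtain c m where c: "c \<in> set spread" "z = encode c m"
    using spread_covers mem_words by blast
  have "P \<subseteq> line_of c"
    unfolding x(2)
  proof (rule vec.span_minimal)
    show "{x} \<subseteq> line_of c"
      using z c by (simp add: line_of_def)
    show "vec.subspace (line_of c)"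
      using line_line_of by (auto simp: line_def)
  qed
  with c show "\<exists>L\<in>line_of ` set spread. P \<subseteq> L"
    by blast
qed

lemma card_simplex_vectors: "card {x :: 'a ^ 5. simplex_vector x} = 405"
proof -
  have "{x. simplex_vector x} = vec_of ` set (filter simplex_word words)"
  proof (intro equalityI subsetI)
    fix x :: "'a ^ 5" assume "x \<in> {x. simplex_vector x}"
    moreover obtain z where "x = vec_of z"
      using vec_of_surj by blast
    ultimately show "x \<in> vec_of ` set (filter simplex_word words)"
      by (simp add: simplex_vector_vec_of mem_words)
  qed (auto simp: simplex_vector_vec_of simp del: vec_of.simps)
  moreover have "inj_on vec_of (set (filter simplex_word words))"
    using vec_of_inject by (simp add: inj_on_def)
  moreover have "card (set (filter simplex_word words)) = 405"
    using length_simplex_words distinct_words by (subst distinct_card) simp_all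
  ultimately show ?thesis
    by (simp only: card_image)
qed

lemma distance_partition_base:
  "\<exists>X3 X1 X0.
     at_distance \<Gamma> (line_of base) 2 = X3 \<union> X1 \<union> X0 \<and>
     X3 \<inter> X1 = {} \<and> X3 \<inter> X0 = {} \<and> X1 \<inter> X0 = {} \<and>
     card X3 = 20 \<and>
     (\<forall>M\<in>X3. card {N \<in> at_distance \<Gamma> (line_of base) 3. M \<rightarrow>\<^bsub>\<Gamma>\<^esub> N} = 3) \<and>
     card X1 = 90 \<and>
     (\<forall>M\<in>X1. \<exists>!N. N \<in> at_distance \<Gamma> (line_of base) 3 \<and> M \<rightarrow>\<^bsub>\<Gamma>\<^esub> N) \<and>
     card X0 = 20 \<and>
     (\<forall>M\<in>X0. \<forall>N\<in>at_distance \<Gamma> (line_of base) 3. disjoint_lines M N) \<and>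
     card {P :: ('a ^ 5) set. simplex_point P} = 135 \<and>
     card ({line_of base} \<union> at_distance \<Gamma> (line_of base) 3 \<union> X0) = 27 \<and>
     simplex_spread ({line_of base} \<union> at_distance \<Gamma> (line_of base) 3 \<union> X0)"
proof (intro exI conjI ballI)
  let ?X = "\<lambda>k. line_of ` set (sphere2_class k)"
  show "at_distance \<Gamma> (line_of base) 2 = ?X 3 \<union> ?X 1 \<union> ?X 0"
    unfolding at_distance_base sphere2_eq by (simp only: image_Un)
  show "?X 3 \<inter> ?X 1 = {}" "?X 3 \<inter> ?X 0 = {}" "?X 1 \<inter> ?X 0 = {}"
    by (simp_all add: sphere2_class_disjoint flip: image_Int[OF inj_line_of])
  show "card (?X 3) = 20" "card (?X 1) = 90" "card (?X 0) = 20"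
    by (simp_all only: card_line_of_image card_sphere2_class)
  have card_neighbours: "card {N \<in> at_distance \<Gamma> (line_of base) 3. M \<rightarrow>\<^bsub>\<Gamma>\<^esub> N} = k"
    if "M \<in> ?X k" for M k
    using that by (auto simp: mem_sphere2_class sphere3_neighbours simp del: with_proj_simps)
  show "card {N \<in> at_distance \<Gamma> (line_of base) 3. M \<rightarrow>\<^bsub>\<Gamma>\<^esub> N} = 3" if "M \<in> ?X 3" for M
    using card_neighbours that .
  show "\<exists>!N. N \<in> at_distance \<Gamma> (line_of base) 3 \<and> M \<rightarrow>\<^bsub>\<Gamma>\<^esub> N" if "M \<in> ?X 1" for M
    using card_neighbours[OF that] by (auto simp: card_1_singleton_iff set_eq_iff Ex1_def)
  show "disjoint_lines M N" if M: "M \<in> ?X 0" and N: "N \<in> at_distance \<Gamma> (line_of base) 3" for M N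
  proof -
    obtain c d where "M = line_of c" "N = line_of d" "c \<in> set (sphere2_class 0)" "d \<in> set sphere3"
      using M N by (auto simp: at_distance_base)
    moreover have "finite {d \<in> set sphere3. meets c d}"
      by simp
    ultimately have "{d \<in> set sphere3. meets c d} = {}"
      by (simp only: mem_sphere2_class card_0_eq)
    then show ?thesis
      using disjoint_lines_line_of \<open>M = line_of c\<close> \<open>N = line_of d\<close> \<open>d \<in> set sphere3\<close> by blast
  qed
  \<comment> \<open>Each point has three non-zero vectors, and 405 = 3 * 135.\<close>
  show "card {P :: ('a ^ 5) set. simplex_point P} = 135"
    using card_simplex_points[where 'a = 'a] card card_simplex_vectors by simp
  have spread: "{line_of base} \<union> at_distance \<Gamma> (line_of base) 3 \<union> ?X 0 = line_of ` set spread"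
    by (auto simp: at_distance_base spread_def)
  show "card ({line_of base} \<union> at_distance \<Gamma> (line_of base) 3 \<union> ?X 0) = 27"
    unfolding spread by (simp add: card_spread)
  show "simplex_spread ({line_of base} \<union> at_distance \<Gamma> (line_of base) 3 \<union> ?X 0)"
    unfolding spread by (rule simplex_spread_line_of)
qed

end

theorem theorem1:
  assumes "CARD('a::{field,finite}) = 4"
  shows "let \<Gamma> = with_proj (simplex_graph :: ('a ^ 5) set pair_pre_digraph) in
    Digraph_Component.connected \<Gamma> \<and>
    graph_diameter \<Gamma> = 3 \<and>
    card (verts \<Gamma>) = 162 \<and>
    (\<forall>L\<in>verts \<Gamma>. out_degree \<Gamma> L = 25) \<and>
    (\<forall>L\<in>verts \<Gamma>.
       card (at_distance \<Gamma> L 3) = 6 \<and>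
       card (at_distance \<Gamma> L 2) = 130 \<and>
       (\<exists>X3 X1 X0.
          at_distance \<Gamma> L 2 = X3 \<union> X1 \<union> X0 \<and>
          X3 \<inter> X1 = {} \<and> X3 \<inter> X0 = {} \<and> X1 \<inter> X0 = {} \<and>
          card X3 = 20 \<and>
          (\<forall>M\<in>X3. card {N \<in> at_distance \<Gamma> L 3. M \<rightarrow>\<^bsub>\<Gamma>\<^esub> N} = 3) \<and>
          card X1 = 90 \<and>
          (\<forall>M\<in>X1. \<exists>!N. N \<in> at_distance \<Gamma> L 3 \<and> M \<rightarrow>\<^bsub>\<Gamma>\<^esub> N) \<and>
          card X0 = 20 \<and>
          (\<forall>M\<in>X0. \<forall>N\<in>at_distance \<Gamma> L 3. disjoint_lines M N) \<and>
          card {P :: ('a ^ 5) set. simplex_point P} = 135 \<and>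
          card ({L} \<union> at_distance \<Gamma> L 3 \<union> X0) = 27 \<and>
          simplex_spread ({L} \<union> at_distance \<Gamma> L 3 \<union> X0)))"
proof -
  let ?G = "with_proj (simplex_graph :: ('a ^ 5) set pair_pre_digraph)"
  have frame: "\<exists>w t. frame w t \<and> frame.line_of w t base = L" if "L \<in> verts ?G" for L
    using simplex_line_frame[OF assms] that by (simp add: simplex_graph_def)
  have le: "graph_distance ?G L M \<le> 3" and reach: "L \<rightarrow>\<^sup>*\<^bsub>?G\<^esub> M"
    if L: "L \<in> verts ?G" and M: "M \<in> verts ?G" for L M
  proof -
    obtain w t where wt: "frame w t" "frame.line_of w t base = L"
      using frame[OF L] by blast
    show "graph_distance ?G L M \<le> 3" "L \<rightarrow>\<^sup>*\<^bsub>?G\<^esub> M"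
      using frame.graph_distance_base_le[OF wt(1) M] frame.base_reachable[OF wt(1) M] wt(2) by simp_all
  qed
  have at2: "card (at_distance ?G L 2) = 130" and at3: "card (at_distance ?G L 3) = 6"
    and degree: "out_degree ?G L = 25" if L: "L \<in> verts ?G" for L
  proof -
    obtain w t where wt: "frame w t" "frame.line_of w t base = L"
      using frame[OF L] by blast
    interpret frame w t
      by (rule wt(1))
    show "card (at_distance ?G L 2) = 130" "card (at_distance ?G L 3) = 6" "out_degree ?G L = 25"
      using at_distance_base card_line_of_image card_spheres out_degree_base unfolding wt(2) by simp_all
  qed
  obtain w :: 'a where w: "w \<noteq> 0" "w \<noteq> 1"
  proof -
    have "UNIV \<noteq> {0, 1 :: 'a}"
    proof
      assume "UNIV = {0, 1 :: 'a}"
      then have "CARD('a) = card {0, 1 :: 'a}"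
        by (rule arg_cong)
      then show False
        by (simp add: assms)
    qed
    then show thesis
      using that by auto
  qed
  \<comment> \<open>For claims that mention no particular line, any frame will do; this one leaves
    the coordinates unscaled.\<close>
  interpret frame w "\<chi> i. 1"
    by unfold_locales (simp_all add: assms w)
  have card_verts: "card (verts ?G) = 162"
    using length_codes distinct_codes by (simp add: verts_\<Gamma> distinct_card del: with_proj_simps)
  \<comment> \<open>The bound 3 is attained because six lines lie at distance 3 from
    \<open>L\<close>.\<close>
  have "(SUP M\<in>verts ?G. graph_distance ?G L M) = 3" if L: "L \<in> verts ?G" for L
  proof (rule antisym)
    have "at_distance ?G L 3 \<noteq> {}"
      using at3[OF L] by auto
    then obtain M where M: "M \<in> verts ?G" "graph_distance ?G L M = 3"
      by (auto simp: at_distance_def)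
    show "3 \<le> (SUP M\<in>verts ?G. graph_distance ?G L M)"
      using SUP_upper[OF M(1), of "graph_distance ?G L"] M(2) by simp
    show "(SUP M\<in>verts ?G. graph_distance ?G L M) \<le> 3"
      using le[OF L] by (rule SUP_least)
  qed
  then have "graph_diameter ?G = (SUP L\<in>verts ?G. 3)"
    unfolding graph_diameter_def by (rule SUP_cong[OF refl])
  then have diameter: "graph_diameter ?G = 3"
    using base_in_verts SUP_const[of "verts ?G" "3 :: ereal"] by (metis empty_iff)
  have "strongly_connected ?G"
    using base_in_verts reach by (auto simp: strongly_connected_def simp del: with_proj_simps)
  \<comment> \<open>\<open>connected\<close> speaks of the symmetric closure, to which reachability
    in the graph itself carries over.\<close>
  then have connected: "Digraph_Component.connected ?G"
    using wf_digraph.reachable_mk_symmetricI[OF wf_digraph_\<Gamma>]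
    by (auto simp: connected_def strongly_connected_def)
  show ?thesis
    unfolding Let_def
  proof (intro conjI ballI)
    fix L assume "L \<in> verts ?G"
    then obtain w t where wt: "frame w t" "frame.line_of w t base = L"
      using frame by blast
    show "\<exists>X3 X1 X0.
          at_distance ?G L 2 = X3 \<union> X1 \<union> X0 \<and>
          X3 \<inter> X1 = {} \<and> X3 \<inter> X0 = {} \<and> X1 \<inter> X0 = {} \<and>
          card X3 = 20 \<and>
          (\<forall>M\<in>X3. card {N \<in> at_distance ?G L 3. M \<rightarrow>\<^bsub>?G\<^esub> N} = 3) \<and>
          card X1 = 90 \<and>
          (\<forall>M\<in>X1. \<exists>!N. N \<in> at_distance ?G L 3 \<and> M \<rightarrow>\<^bsub>?G\<^esub> N) \<and>
          card X0 = 20 \<and>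
          (\<forall>M\<in>X0. \<forall>N\<in>at_distance ?G L 3. disjoint_lines M N) \<and>
          card {P :: ('a ^ 5) set. simplex_point P} = 135 \<and>
          card ({L} \<union> at_distance ?G L 3 \<union> X0) = 27 \<and>
          simplex_spread ({L} \<union> at_distance ?G L 3 \<union> X0)"
      using frame.distance_partition_base[OF wt(1)] unfolding wt(2) .
  qed (fact connected diameter card_verts | erule degree at3 at2)+
qed

end
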